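(* Let $n\ge 3$ be an integer, and let $G$ be a finite simple connected graph with $N_0$ vertices and $E_0\ge 1$ edges. Let $CL(G)$ be the clique-blew up graph of $G$ (each edge of $G$ replaced by a complete graph $K_n$), and let $\mathcal{L}_G$ and $\mathcal{L}_C$ be the normalized Laplacian matrices of $G$ and $CL(G)$, respectively. Then the normalized Laplacian spectrum of $CL(G)$ is given as follows. (i) The value $0$ is an eigenvalue of $\mathcal{L}_C$ with multiplicity $1$. (ii) If $\lambda$ (with $\lambda\neq 0,2$) is an eigenvalue of $\mathcal{L}_G$, then $\frac{\lambda}{n-1}$ is an eigenvalue of $\mathcal{L}_C$ and $m_{\mathcal{L}_C}\left(\frac{\lambda}{n-1}\right)=m_{\mathcal{L}_G}(\lambda)$. (iii) If $G$ is non-bipartite, then $\frac{2}{n-1}$ is an eigenvalue of $\mathcal{L}_C$ with multiplicity $E_0-N_0$. (iv) If $G$ is bipartite, then $\frac{2}{n-1}$ is an eigenvalue of $\mathcal{L}_C$ with multiplicity $E_0-N_0+1$. (v) The value $\frac{n}{n-1}$ is an eigenvalue of $\mathcal{L}_C$ with multiplicity $(n-3)E_0+N_0$. These eigenvalues, with these multiplicities, form the whole spectrum of $\mathcal{L}_C$.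
   Context: Clique-blew up graph: fix an integer $n\ge 3$. For a graph $G$, the graph $CL(G)$ is obtained from $G$ by adding, for every edge $e$ of $G$, $n-2$ new vertices $k^e_1,\dots,k^e_{n-2}$ (distinct edges receive disjoint sets of new vertices) and the edges needed so that these new vertices together with the two end-vertices of $e$ form a complete graph $K_n$. Normalized Laplacian: for a graph $H$ with all vertex degrees $d_i$ positive and adjacency matrix $A_H$, $\mathcal{L}_H$ is the matrix with entries $\mathcal{L}_H(i,j)=\delta_{ij}-\frac{A_H(i,j)}{\sqrt{d_id_j}}$. The normalized Laplacian spectrum of $H$ is the multiset of eigenvalues of $\mathcal{L}_H$. For a matrix $M$, $m_M(\lambda)$ denotes the multiplicity of $\lambda$ as an eigenvalue of $M$. A stated multiplicity equal to $0$ means that the value is not an eigenvalue. *)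

theory Defs
  imports
    "Jordan_Normal_Form.Char_Poly"
    "Graph_Theory.Graph_Theory"
begin

text \<open>
  A finite simple graph is a \<^locale>\<open>pair_graph\<close>: a finite, loop-free digraph with a symmetric arc
  relation \<^const>\<open>parcs\<close>. Every undirected edge is thus represented by two arcs, so edges have
  to be counted as two-element vertex sets.
\<close>

definition edges :: "'a pair_pre_digraph \<Rightarrow> 'a set set" where
  "edges G = (\<lambda>(u, v). {u, v}) ` parcs G"

definition bipartite :: "'a pair_pre_digraph \<Rightarrow> bool" where
  "bipartite G \<longleftrightarrow> (\<exists>U W. U \<union> W = pverts G \<and> U \<inter> W = {} \<and>
     (\<forall>(u, v) \<in> parcs G. (u \<in> U \<and> v \<in> W) \<or> (u \<in> W \<and> v \<in> U)))"

text \<open>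
  \<open>New e i\<close> is the \<open>i\<close>-th vertex added for the edge \<open>e\<close>.
\<close>

datatype 'a cl_vertex = Old 'a | New "'a set" nat

definition clique_of :: "nat \<Rightarrow> 'a set \<Rightarrow> 'a cl_vertex set" where
  "clique_of n e = Old ` e \<union> New e ` {1..n - 2}"

text \<open>
  The edges of \<open>G\<close> itself survive in \<open>clique_blowup n G\<close>, because both ends of an edge \<open>e\<close> belong to
  \<open>clique_of n e\<close>.
\<close>

definition clique_blowup :: "nat \<Rightarrow> 'a pair_pre_digraph \<Rightarrow> 'a cl_vertex pair_pre_digraph" where
  "clique_blowup n G =
     \<lparr> pverts = Old ` pverts G \<union> (\<Union>e \<in> edges G. New e ` {1..n - 2}),
       parcs = {(x, y). x \<noteq> y \<and> (\<exists>e \<in> edges G. x \<in> clique_of n e \<and> y \<in> clique_of n e)} \<rparr>"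

text \<open>
  Matrices are indexed by natural numbers, so a graph matrix is taken with respect to a listing \<open>vs\<close>
  of the vertices. In a \<^locale>\<open>pair_graph\<close> the out-degree of a vertex is its degree.
\<close>

definition adjacency_matrix :: "'a pair_pre_digraph \<Rightarrow> 'a list \<Rightarrow> real mat" where
  "adjacency_matrix H vs =
     mat (length vs) (length vs) (\<lambda>(i, j). if (vs ! i, vs ! j) \<in> parcs H then 1 else 0)"

definition normalized_laplacian :: "'a pair_pre_digraph \<Rightarrow> 'a list \<Rightarrow> real mat" where
  "normalized_laplacian H vs =
     mat (length vs) (length vs) (\<lambda>(i, j).
       (if i = j then 1 else 0) -
       adjacency_matrix H vs $$ (i, j) /
         sqrt (real (out_degree (with_proj H) (vs ! i)) * real (out_degree (with_proj H) (vs ! j))))"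

text \<open>
  Multiplicities are algebraic; for the symmetric matrices considered here they agree with the
  geometric ones.
\<close>

definition eig_mult :: "real mat \<Rightarrow> real \<Rightarrow> nat" where
  "eig_mult M x = order x (char_poly M)"

definition eig_mset :: "real mat \<Rightarrow> real multiset" where
  "eig_mset M = proots (char_poly M)"

end

theory Submission
  imports Defs "Jordan_Normal_Form.Schur_Decomposition"
begin

text \<open>
  The proof compares two Gram matrices. Suppose the edges of a graph \<open>H\<close> are partitioned into
  \<open>k\<close>-cliques, and let \<open>N\<close> be the vertex-clique incidence matrix in which the row of a vertex \<open>x\<close> is
  divided by the square root of the number of cliques through \<open>x\<close>. That number is the degree of
  \<open>x\<close> divided by \<open>k - 1\<close>, so \<open>N N\<^sup>T = k I - (k - 1) L\<close>, where \<open>L\<close> is the normalized Laplacian of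
  \<open>H\<close> (lemma \<open>incidence_times_transpose\<close>). Two instances matter: \<open>G\<close> with its edges as
  2-cliques, giving a matrix \<open>R\<close>, and the blow-up with its \<open>n\<close>-cliques, giving a matrix \<open>M\<close>.

  The cliques of the blow-up are indexed by the edges of \<open>G\<close>, and the new vertices of a clique lie
  in no other clique. Hence each adds 1 to a diagonal entry of \<open>M\<^sup>T M\<close> and nothing elsewhere,
  whereas the old vertices contribute what they contribute to \<open>R\<^sup>T R\<close>. This yields
  \<open>M\<^sup>T M = (n - 2) I + R\<^sup>T R\<close> (lemma \<open>blowup_gram\<close>). As \<open>N N\<^sup>T\<close> and \<open>N\<^sup>T N\<close> have the
  same spectrum up to zeros, going from \<open>L\<close> for \<open>G\<close> to \<open>R R\<^sup>T\<close>, \<open>R\<^sup>T R\<close>, \<open>M\<^sup>T M\<close>,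
  \<open>M M\<^sup>T\<close> and finally \<open>L\<close> for the blow-up sends an eigenvalue \<open>\<lambda>\<close> to \<open>\<lambda> / (n - 1)\<close>. The zeros
  gained or lost by exchanging \<open>R R\<^sup>T\<close> with \<open>R\<^sup>T R\<close> become copies of \<open>2 / (n - 1)\<close>, and those
  from exchanging \<open>M\<^sup>T M\<close> with \<open>M M\<^sup>T\<close> become copies of \<open>n / (n - 1)\<close> (lemma
  \<open>blowup_spectrum_balance\<close>).

  It remains to know the multiplicities of 0 and 2 in the spectrum of \<open>G\<close>. Both are of the form
  \<open>1 - s\<close> with \<open>s = 1\<close> or \<open>s = -1\<close>. A sum of squares shows that, after rescaling by the square roots
  of the degrees, the eigenvectors are exactly the functions that are multiplied by \<open>s\<close> along
  every edge. By connectedness they form a space of dimension at most 1; it is nonzero for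
  \<open>s = 1\<close>, and for \<open>s = -1\<close> precisely when \<open>G\<close> is bipartite. For a
  symmetric matrix, an eigenspace of dimension 1 belongs to a simple root of the characteristic
  polynomial (lemma \<open>symmetric_simple_eigenvalue\<close>).
\<close>

section \<open>Spectra of real symmetric matrices\<close>

text \<open>
  Both sides are values of the determinant of the block matrix with rows \<open>(x I, A)\<close> and \<open>(B, I)\<close>,
  whose lower left block is cleared by the block triangular factor \<open>S\<close> from the right or \<open>T\<close>
  from the left. The determinants of these factors are 1 and \<open>x ^ c\<close>; scaling by \<open>x\<close> in \<open>T\<close> avoids
  dividing by \<open>x\<close>.
\<close>

lemma det_scaled_one_minus_mult:
  fixes A B :: "real mat"
  assumes A: "A \<in> carrier_mat r c" and B: "B \<in> carrier_mat c r"
  shows "x ^ c * det (x \<cdot>\<^sub>m 1\<^sub>m r - A * B) = x ^ r * det (x \<cdot>\<^sub>m 1\<^sub>m c - B * A)"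
proof -
  define K where "K = four_block_mat (x \<cdot>\<^sub>m 1\<^sub>m r) A B (1\<^sub>m c)"
  \<comment> \<open>\<open>K * S\<close> and \<open>T * K\<close> are both block upper triangular.\<close>
  define S where "S = four_block_mat (1\<^sub>m r) (0\<^sub>m r c) (- B) (1\<^sub>m c)"
  define T where "T = four_block_mat (1\<^sub>m r) (0\<^sub>m r c) (- B) (x \<cdot>\<^sub>m 1\<^sub>m c)"
  have K: "K \<in> carrier_mat (r + c) (r + c)" and S: "S \<in> carrier_mat (r + c) (r + c)"
    and T: "T \<in> carrier_mat (r + c) (r + c)"
    unfolding K_def S_def T_def using A B by auto
  have BA: "B * A \<in> carrier_mat c c" and AB: "A * B \<in> carrier_mat r r"
    using A B by auto
  have "K * S = four_block_mat ((x \<cdot>\<^sub>m 1\<^sub>m r) * 1\<^sub>m r + A * (- B)) ((x \<cdot>\<^sub>m 1\<^sub>m r) * 0\<^sub>m r c + A * 1\<^sub>m c)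
      (B * 1\<^sub>m r + 1\<^sub>m c * (- B)) (B * 0\<^sub>m r c + 1\<^sub>m c * 1\<^sub>m c)"
    unfolding K_def S_def
    by (rule mult_four_block_mat[where ?nr1.0 = r and ?nr2.0 = c and ?n1.0 = r and ?n2.0 = c
          and ?nc1.0 = r and ?nc2.0 = c]) (use A B in auto)
  also have "\<dots> = four_block_mat (x \<cdot>\<^sub>m 1\<^sub>m r - A * B) A (0\<^sub>m c r) (1\<^sub>m c)"
    using A B by (intro cong_four_block_mat eq_matI) auto
  finally have KS: "K * S = \<dots>" .
  have "T * K = four_block_mat (1\<^sub>m r * (x \<cdot>\<^sub>m 1\<^sub>m r) + 0\<^sub>m r c * B) (1\<^sub>m r * A + 0\<^sub>m r c * 1\<^sub>m c)
      (- B * (x \<cdot>\<^sub>m 1\<^sub>m r) + (x \<cdot>\<^sub>m 1\<^sub>m c) * B) (- B * A + (x \<cdot>\<^sub>m 1\<^sub>m c) * 1\<^sub>m c)"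
    unfolding K_def T_def
    by (rule mult_four_block_mat[where ?nr1.0 = r and ?nr2.0 = c and ?n1.0 = r and ?n2.0 = c
          and ?nc1.0 = r and ?nc2.0 = c]) (use A B in auto)
  also have "\<dots> = four_block_mat (x \<cdot>\<^sub>m 1\<^sub>m r) A (0\<^sub>m c r) (x \<cdot>\<^sub>m 1\<^sub>m c - B * A)"
    using A B by (intro cong_four_block_mat eq_matI) (auto simp: mult_smult_distrib)
  finally have TK: "T * K = \<dots>" .
  have B': "- B \<in> carrier_mat c r" using B by simp
  have "det S = det (1\<^sub>m r) * det (1\<^sub>m c)"
    unfolding S_def by (rule det_four_block_mat_upper_right_zero[OF _ refl B']) simp_all
  then have "det K = det K * det S" by simp
  also have "\<dots> = det (x \<cdot>\<^sub>m 1\<^sub>m r - A * B)"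
    unfolding det_mult[OF K S, symmetric] KS
    by (subst det_four_block_mat_lower_left_zero[OF _ A refl one_carrier_mat]) (use AB in \<open>auto intro!: minus_carrier_mat\<close>)
  finally have K1: "det K = det (x \<cdot>\<^sub>m 1\<^sub>m r - A * B)" .
  have "det T = det (1\<^sub>m r) * det (x \<cdot>\<^sub>m 1\<^sub>m c)"
    unfolding T_def by (rule det_four_block_mat_upper_right_zero[OF _ refl B']) simp_all
  then have "x ^ c * det K = det T * det K" by simp
  also have "\<dots> = x ^ r * det (x \<cdot>\<^sub>m 1\<^sub>m c - B * A)"
    unfolding det_mult[OF T K, symmetric] TK
    by (subst det_four_block_mat_lower_left_zero[OF _ A refl]) (use BA in \<open>auto intro!: minus_carrier_mat\<close>)
  finally show ?thesis using K1 by simp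
qed

lemma poly_char_poly_eq_det:
  fixes A :: "real mat"
  assumes "A \<in> carrier_mat n n"
  shows "poly (char_poly A) x = det (x \<cdot>\<^sub>m 1\<^sub>m n - A)"
proof -
  have "- char_matrix A x = x \<cdot>\<^sub>m 1\<^sub>m n - A"
    using assms unfolding char_matrix_def by (intro eq_matI) auto
  then show ?thesis using char_poly_matrix[OF assms] by simp
qed

lemma char_poly_nonzero:
  fixes A :: "real mat"
  assumes "A \<in> carrier_mat n n"
  shows "char_poly A \<noteq> 0"
  using degree_monic_char_poly[OF assms] by auto

lemma count_eig_mset:
  assumes "A \<in> carrier_mat n n"
  shows "count (eig_mset A) x = eig_mult A x"
  using char_poly_nonzero[OF assms] by (simp add: eig_mset_def eig_mult_def)

lemma eigenvalue_iff_in_eig_mset: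
  assumes "A \<in> carrier_mat n n"
  shows "eigenvalue A x \<longleftrightarrow> x \<in># eig_mset A"
  using char_poly_nonzero[OF assms] eigenvalue_root_char_poly[OF assms]
  by (simp add: eig_mset_def)

lemma eig_mset_mult_commute:
  assumes A: "A \<in> carrier_mat r c" and B: "B \<in> carrier_mat c r"
  shows "eig_mset (A * B) + replicate_mset c 0 = eig_mset (B * A) + replicate_mset r 0"
proof -
  have AB: "A * B \<in> carrier_mat r r" and BA: "B * A \<in> carrier_mat c c" using A B by auto
  have "char_poly (A * B) * [:0, 1:] ^ c = char_poly (B * A) * [:0, 1:] ^ r"
    by (rule poly_ext)
       (use det_scaled_one_minus_mult[OF A B] in
         \<open>simp add: poly_char_poly_eq_det[OF AB] poly_char_poly_eq_det[OF BA] mult.commute\<close>)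
  then have "proots (char_poly (A * B) * [:0, 1:] ^ c) = proots (char_poly (B * A) * [:0, 1:] ^ r)"
    by simp
  then show ?thesis
    using char_poly_nonzero[OF AB] char_poly_nonzero[OF BA]
    by (simp add: proots_mult proots_power eig_mset_def)
qed

lemma eig_mset_of_factorization:
  assumes "char_poly A = (\<Prod>e\<leftarrow>es. [:- e, 1:])"
  shows "eig_mset A = mset es"
proof -
  have "proots (\<Prod>e\<leftarrow>es. [:- e, 1:]) = mset es" for es :: "real list"
  proof (induction es)
    case (Cons e es)
    have "(\<Prod>e\<leftarrow>es. [:- e, 1:]) \<noteq> 0"
      by (auto simp: prod_list_zero_iff)
    then show ?case
      using Cons by (simp add: proots_mult del: mult_pCons_left)
  qed simp
  then show ?thesis using assms by (simp add: eig_mset_def)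
qed

text \<open>
  For an eigenvector \<open>v\<close> the number \<open>v\<^sup>* A v\<close> is \<open>k\<close> times the positive number \<open>v\<^sup>* v\<close>, and
  symmetry of \<open>A\<close> makes it equal to its own conjugate.
\<close>

lemma symmetric_eigenvalue_real:
  fixes A :: "real mat"
  assumes A: "A \<in> carrier_mat n n" and sym: "transpose_mat A = A"
    and ev: "eigenvalue (map_mat complex_of_real A) k"
  shows "k \<in> \<real>"
proof -
  from ev obtain v where v: "v \<in> carrier_vec n" "v \<noteq> 0\<^sub>v n"
    and Av: "map_mat complex_of_real A *\<^sub>v v = k \<cdot>\<^sub>v v"
    using A unfolding eigenvalue_def eigenvector_def by auto
  have a_sym: "A $$ (j, i) = A $$ (i, j)" if "i < n" "j < n" for i j
    using A that sym by (metis carrier_matD index_transpose_mat(1))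
  have row: "(\<Sum>j<n. complex_of_real (A $$ (i, j)) * v $ j) = k * v $ i" if "i < n" for i
  proof -
    have "(map_mat complex_of_real A *\<^sub>v v) $ i = k * v $ i"
      using Av v(1) that by simp
    then show ?thesis
      using that A v(1) by (simp add: scalar_prod_def lessThan_atLeast0)
  qed
  define S where "S = (\<Sum>i<n. \<Sum>j<n. cnj (v $ i) * complex_of_real (A $$ (i, j)) * v $ j)"
  define q where "q = (\<Sum>i<n. (cmod (v $ i))\<^sup>2)"
  have "S = (\<Sum>i<n. cnj (v $ i) * (k * v $ i))"
    unfolding S_def by (intro sum.cong refl) (simp add: row[symmetric] sum_distrib_left mult.assoc)
  also have "\<dots> = k * complex_of_real q"
    unfolding q_def of_real_sum sum_distrib_left
    by (intro sum.cong refl) (simp add: complex_norm_square mult_ac del: of_real_power)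
  finally have S: "S = k * complex_of_real q" .
  have "cnj S = (\<Sum>i<n. \<Sum>j<n. v $ i * complex_of_real (A $$ (i, j)) * cnj (v $ j))"
    unfolding S_def by simp
  also have "\<dots> = (\<Sum>j<n. \<Sum>i<n. v $ i * complex_of_real (A $$ (i, j)) * cnj (v $ j))"
    by (rule sum.swap)
  also have "\<dots> = S"
    unfolding S_def by (intro sum.cong refl) (simp add: a_sym mult_ac)
  finally have "cnj k * complex_of_real q = k * complex_of_real q"
    unfolding S by simp
  moreover have "q \<noteq> 0"
  proof
    assume "q = 0"
    then have "v $ i = 0" if "i < n" for i
      using that unfolding q_def by (subst (asm) sum_nonneg_eq_0_iff) auto
    then have "v = 0\<^sub>v n" using v(1) by (intro eq_vecI) auto
    then show False using v(2) by simp
  qed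
  ultimately have "cnj k = k" by simp
  then show ?thesis by (simp add: Reals_cnj_iff)
qed

text \<open>
  The characteristic polynomial factors over the complex numbers, where all its roots are real.
\<close>

lemma symmetric_char_poly_splits:
  fixes A :: "real mat"
  assumes A: "A \<in> carrier_mat n n" and sym: "transpose_mat A = A"
  shows "\<exists>es. char_poly A = (\<Prod>e\<leftarrow>es. [:- e, 1:]) \<and> length es = n"
proof -
  let ?A = "map_mat complex_of_real A"
  have cA: "?A \<in> carrier_mat n n" using A by simp
  obtain as where as: "char_poly ?A = (\<Prod>a\<leftarrow>as. [:- a, 1:])" and len: "length as = n"
    using char_poly_factorized[OF cA] by blast
  have "a \<in> \<real>" if "a \<in> set as" for a
  proof -
    have "poly (char_poly ?A) a = 0"
      using that unfolding as by (auto simp: poly_prod_list prod_list_zero_iff image_iff o_def)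
    then have "eigenvalue ?A a" using eigenvalue_root_char_poly[OF cA] by simp
    then show ?thesis by (rule symmetric_eigenvalue_real[OF A sym])
  qed
  then have as_re: "as = map complex_of_real (map Re as)"
    by (induction as) auto
  interpret h: map_poly_inj_comm_ring_hom complex_of_real ..
  have "map_poly complex_of_real (char_poly A) = (\<Prod>a\<leftarrow>as. [:- a, 1:])"
    unfolding as[symmetric] by (rule of_real_hom.char_poly_hom[OF A, symmetric])
  also have "\<dots> = map_poly complex_of_real (\<Prod>e\<leftarrow>map Re as. [:- e, 1:])"
    unfolding h.hom_prod_list map_map by (subst as_re) (simp add: o_def)
  finally have "char_poly A = (\<Prod>e\<leftarrow>map Re as. [:- e, 1:])"
    by (rule h.injectivity)
  then show ?thesis using len by (intro exI[of _ "map Re as"]) simp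
qed

lemma size_eig_mset_symmetric:
  assumes "A \<in> carrier_mat n n" and "transpose_mat A = A"
  shows "size (eig_mset A) = n"
  using symmetric_char_poly_splits[OF assms] eig_mset_of_factorization by fastforce

text \<open>
  The \<open>n\<close> real roots that symmetry provides are moved one by one.
\<close>

lemma eig_mset_affine:
  fixes A :: "real mat"
  assumes A: "A \<in> carrier_mat n n" and sym: "transpose_mat A = A" and b: "b \<noteq> 0"
  shows "eig_mset (a \<cdot>\<^sub>m 1\<^sub>m n + b \<cdot>\<^sub>m A) = image_mset (\<lambda>e. a + b * e) (eig_mset A)"
proof -
  let ?C = "a \<cdot>\<^sub>m 1\<^sub>m n + b \<cdot>\<^sub>m A"
  have C: "?C \<in> carrier_mat n n" using A by simp
  obtain es where es: "char_poly A = (\<Prod>e\<leftarrow>es. [:- e, 1:])" and len: "length es = n"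
    using symmetric_char_poly_splits[OF A sym] by blast
  have "char_poly ?C = (\<Prod>e\<leftarrow>map (\<lambda>e. a + b * e) es. [:- e, 1:])"
  proof (rule poly_ext)
    fix x
    have "x \<cdot>\<^sub>m 1\<^sub>m n - ?C = b \<cdot>\<^sub>m (((x - a) / b) \<cdot>\<^sub>m 1\<^sub>m n - A)"
      using A b by (intro eq_matI) (auto simp: field_simps)
    then have "poly (char_poly ?C) x = b ^ n * poly (char_poly A) ((x - a) / b)"
      using A by (simp add: poly_char_poly_eq_det[OF A] poly_char_poly_eq_det[OF C])
    also have "\<dots> = b ^ length es * (\<Prod>e\<leftarrow>es. (x - a) / b - e)"
      by (simp add: es len poly_prod_list o_def)
    also have "\<dots> = (\<Prod>e\<leftarrow>es. x - (a + b * e))"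
      using b by (induction es) (auto simp: field_simps)
    also have "\<dots> = poly (\<Prod>e\<leftarrow>map (\<lambda>e. a + b * e) es. [:- e, 1:]) x"
      by (simp add: poly_prod_list o_def algebra_simps)
    finally show "poly (char_poly ?C) x = \<dots>" .
  qed
  then show ?thesis
    using eig_mset_of_factorization[OF es] eig_mset_of_factorization by fastforce
qed

lemma gram_eigenvalue_nonneg:
  fixes N :: "real mat"
  assumes N: "N \<in> carrier_mat r c" and ev: "eigenvalue (N * transpose_mat N) x"
  shows "x \<ge> 0"
proof -
  from ev obtain v where v: "v \<in> carrier_vec r" "v \<noteq> 0\<^sub>v r"
    and Nv: "N * transpose_mat N *\<^sub>v v = x \<cdot>\<^sub>v v"
    using N unfolding eigenvalue_def eigenvector_def by auto
  let ?w = "transpose_mat N *\<^sub>v v"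
  have w: "?w \<in> carrier_vec c" using N v(1) by auto
  have "x * (v \<bullet> v) = v \<bullet> (N *\<^sub>v ?w)"
  proof -
    have "N *\<^sub>v ?w = x \<cdot>\<^sub>v v"
      using assoc_mult_mat_vec[OF N _ v(1), of "transpose_mat N"] N Nv by simp
    then show ?thesis using v(1) by simp
  qed
  also have "\<dots> = ?w \<bullet> ?w"
    using transpose_vec_mult_scalar[OF N w v(1)] by simp
  also have "\<dots> \<ge> 0" by (auto simp: scalar_prod_def intro!: sum_nonneg)
  finally have "x * (v \<bullet> v) \<ge> 0" .
  moreover have "v \<bullet> v > 0"
  proof -
    have "\<exists>i<r. v $ i \<noteq> 0"
    proof (rule ccontr)
      assume "\<not> (\<exists>i<r. v $ i \<noteq> 0)"
      then have "v = 0\<^sub>v r" using v(1) by (intro eq_vecI) auto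
      then show False using v(2) by simp
    qed
    then obtain i where "i < r" "v $ i \<noteq> 0" by blast
    then show ?thesis
      using v(1) unfolding scalar_prod_def by (intro sum_pos2[of _ i]) (auto simp: zero_less_mult_iff neq_iff)
  qed
  ultimately show ?thesis by (simp add: zero_le_mult_iff)
qed

text \<open>
  If \<open>l\<close> were a multiple root, a Schur form of \<open>A\<close> could be arranged to have \<open>l\<close> in its first two
  diagonal places. Its first two basis vectors \<open>p0\<close> and \<open>p1\<close> satisfy \<open>A p0 = l p0\<close> and
  \<open>A p1 = b p0 + l p1\<close>. Comparing \<open>p0 \<bullet> A p1\<close> with \<open>A p0 \<bullet> p1\<close> gives \<open>b = 0\<close>, so \<open>p0\<close> and \<open>p1\<close>
  are independent eigenvectors.
\<close>

lemma symmetric_simple_eigenvalue: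
  fixes A :: "real mat"
  assumes A: "A \<in> carrier_mat n n" and sym: "transpose_mat A = A"
    and one_dim: "\<And>v w. eigenvector A v l \<Longrightarrow> eigenvector A w l \<Longrightarrow> \<exists>c. w = c \<cdot>\<^sub>v v"
  shows "eig_mult A l \<le> 1"
proof (rule ccontr)
  assume "\<not> eig_mult A l \<le> 1"
  then have count: "count (eig_mset A) l \<ge> 2" using count_eig_mset[OF A] by simp
  obtain es where es: "char_poly A = (\<Prod>e\<leftarrow>es. [:- e, 1:])" and len: "length es = n"
    using symmetric_char_poly_splits[OF A sym] by blast
  \<comment> \<open>The factorization may be listed in any order, so \<open>l\<close> is put in front twice.\<close>
  define rest where "rest = remove1 l (remove1 l es)"
  have perm: "mset es = mset (l # l # rest)"
    using count unfolding rest_def eig_mset_of_factorization[OF es]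
    by (intro multiset_eqI) auto
  then have "prod_mset (image_mset (\<lambda>e. [:- e, 1:]) (mset es))
      = prod_mset (image_mset (\<lambda>e. [:- e, 1:]) (mset (l # l # rest)))" by simp
  then have es': "char_poly A = (\<Prod>e\<leftarrow>l # l # rest. [:- e, 1:])"
    unfolding es by (simp only: mset_map[symmetric] prod_mset_prod_list)
  have n: "n \<ge> 2" using perm len by (metis One_nat_def Suc_leI length_Cons numeral_2_eq_2 size_mset zero_less_Suc not_less_eq_eq)
  obtain B P Q where "schur_decomposition A (l # l # rest) = (B, P, Q)"
    by (cases "schur_decomposition A (l # l # rest)")
  from schur_decomposition[OF A es' this]
  have wit: "similar_mat_wit A B P Q" and ut: "upper_triangular B"
    and diag: "diag_mat B = l # l # rest" by auto
  note w = similar_mat_witD2[OF A wit]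
  have B00: "B $$ (0, 0) = l" and B11: "B $$ (1, 1) = l"
    using diag n w(5) unfolding diag_mat_def
    by (metis (no_types, lifting) add_0 carrier_matD(1) length_map length_upt nth_Cons_0 nth_map nth_upt diff_zero less_le_trans zero_less_numeral,
        metis (no_types, lifting) One_nat_def Suc_1 Suc_le_lessD add_0 carrier_matD(1) length_upt nth_Cons_0 nth_Cons_Suc nth_map nth_upt diff_zero)
  define b where "b = B $$ (0, 1)"
  define p0 where "p0 = col P 0"
  define p1 where "p1 = col P 1"
  have p: "p0 \<in> carrier_vec n" "p1 \<in> carrier_vec n"
    unfolding p0_def p1_def using w n by auto
  have "A * P = P * B * (Q * P)"
    unfolding w(3) using w by (simp add: assoc_mult_mat[of _ n n _ n _ n])
  then have AP: "A * P = P * B" using w by simp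
  have col: "A *\<^sub>v col P j = P *\<^sub>v col B j" if "j < n" for j
    using col_mult2[OF w(4) w(6) that] col_mult2[OF w(6) w(5) that] AP by simp
  have P_unit: "P *\<^sub>v unit_vec n j = col P j" if "j < n" for j
    using col_mult2[OF w(6) one_carrier_mat that] w(6) that by simp
  have "col B 0 = l \<cdot>\<^sub>v unit_vec n 0"
    using w(5) n ut B00 by (intro eq_vecI) (auto simp: upper_triangular_def)
  then have Ap0: "A *\<^sub>v p0 = l \<cdot>\<^sub>v p0"
    using col[of 0] n w(6) mult_mat_vec[OF w(6) unit_vec_carrier] P_unit[of 0]
    unfolding p0_def by simp
  have "col B 1 = b \<cdot>\<^sub>v unit_vec n 0 + l \<cdot>\<^sub>v unit_vec n 1"
    using w(5) n ut B11 b_def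
    by (intro eq_vecI) (auto simp: upper_triangular_def unit_vec_def less_Suc_eq not_less_iff_gr_or_eq)
  then have Ap1: "A *\<^sub>v p1 = b \<cdot>\<^sub>v p0 + l \<cdot>\<^sub>v p1"
    using col[of 1] n w(6) mult_mat_vec[OF w(6) unit_vec_carrier] P_unit
      mult_add_distrib_mat_vec[OF w(6)]
    unfolding p0_def p1_def by simp
  have unit: "Q *\<^sub>v col P j = unit_vec n j" if "j < n" for j
    using col_mult2[OF w(7) w(6) that] w(2) that by simp
  have indep: "p1 \<noteq> c \<cdot>\<^sub>v p0" for c
  proof
    assume "p1 = c \<cdot>\<^sub>v p0"
    then have "Q *\<^sub>v p1 = c \<cdot>\<^sub>v (Q *\<^sub>v p0)" using mult_mat_vec[OF w(7) p(1)] by simp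
    then have "unit_vec n 1 = c \<cdot>\<^sub>v unit_vec n 0"
      using unit n unfolding p0_def p1_def by simp
    then have "unit_vec n 1 $ 1 = (c \<cdot>\<^sub>v (unit_vec n 0 :: real vec)) $ 1" by simp
    then show False using n by simp
  qed
  have p0_nz: "p0 \<noteq> 0\<^sub>v n"
  proof
    assume "p0 = 0\<^sub>v n"
    then have "p0 = 0 \<cdot>\<^sub>v p0" by (intro eq_vecI) auto
    then have "Q *\<^sub>v p0 = 0 \<cdot>\<^sub>v (Q *\<^sub>v p0)" using mult_mat_vec[OF w(7) p(1)] by metis
    then have "unit_vec n 0 $ 0 = (0 \<cdot>\<^sub>v (unit_vec n 0 :: real vec)) $ 0"
      using unit[of 0] n unfolding p0_def by simp
    then show False using n by simp
  qed
  have p1_nz: "p1 \<noteq> 0\<^sub>v n"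
  proof
    assume "p1 = 0\<^sub>v n"
    then have "p1 = 0 \<cdot>\<^sub>v p0" using p by (intro eq_vecI) auto
    then show False using indep by blast
  qed
  have "l * (p0 \<bullet> p1) = (A *\<^sub>v p0) \<bullet> p1" using Ap0 p by simp
  also have "\<dots> = p0 \<bullet> (A *\<^sub>v p1)"
    using transpose_vec_mult_scalar[OF A p(2) p(1)] sym by simp
  also have "\<dots> = b * (p0 \<bullet> p0) + l * (p0 \<bullet> p1)"
    unfolding Ap1 using p by (simp add: scalar_prod_add_distrib[of _ n])
  finally have "b * (p0 \<bullet> p0) = 0" by simp
  moreover have "p0 \<bullet> p0 \<noteq> 0"
  proof
    assume "p0 \<bullet> p0 = 0"
    then have "p0 $ i = 0" if "i < n" for i
      using that p unfolding scalar_prod_def by (subst (asm) sum_nonneg_eq_0_iff) auto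
    then show False using p0_nz p(1) by (metis eq_vecI carrier_vecD index_zero_vec)
  qed
  ultimately have "b = 0" by simp
  then have "A *\<^sub>v p1 = l \<cdot>\<^sub>v p1" using Ap1 p by auto
  then have "eigenvector A p0 l" "eigenvector A p1 l"
    unfolding eigenvector_def using A p p0_nz p1_nz Ap0 by auto
  then show False using one_dim indep by blast
qed

section \<open>Graphs whose edges are partitioned into cliques\<close>

lemma sum_nth_distinct:
  assumes "distinct xs"
  shows "(\<Sum>i<length xs. g (xs ! i)) = sum g (set xs)"
  by (rule sum.reindex_bij_betw[OF bij_betw_nth]) (use assms in auto)

lemma out_degree_eq_card: "out_degree (with_proj H) u = card {w. (u, w) \<in> parcs H}"
proof -
  have "out_arcs (with_proj H) u = Pair u ` {w. (u, w) \<in> parcs H}"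
    by (auto simp: out_arcs_def)
  then show ?thesis by (simp add: out_degree_def card_image inj_on_def)
qed

lemma normalized_laplacian_carrier [simp]:
  "normalized_laplacian H xs \<in> carrier_mat (length xs) (length xs)"
  by (simp add: normalized_laplacian_def)

lemma normalized_laplacian_symmetric:
  assumes "sym (parcs H)"
  shows "transpose_mat (normalized_laplacian H xs) = normalized_laplacian H xs"
  using assms by (intro eq_matI) (auto simp: normalized_laplacian_def adjacency_matrix_def mult.commute dest: symD)

definition clique_degree :: "'b set set \<Rightarrow> 'b \<Rightarrow> nat" where
  "clique_degree C x = card {c \<in> C. x \<in> c}"

definition clique_incidence_matrix :: "'b list \<Rightarrow> 'b set list \<Rightarrow> real mat" where
  "clique_incidence_matrix xs cs = mat (length xs) (length cs)
     (\<lambda>(i, j). if xs ! i \<in> cs ! j then 1 / sqrt (clique_degree (set cs) (xs ! i)) else 0)"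

lemma clique_incidence_matrix_carrier [simp]:
  "clique_incidence_matrix xs cs \<in> carrier_mat (length xs) (length cs)"
  by (simp add: clique_incidence_matrix_def)

lemma clique_incidence_gram:
  assumes xs: "distinct xs" and i: "i < length cs" and j: "j < length cs"
    and sub: "cs ! i \<subseteq> set xs"
  shows "(transpose_mat (clique_incidence_matrix xs cs) * clique_incidence_matrix xs cs) $$ (i, j)
    = (\<Sum>x \<in> cs ! i \<inter> cs ! j. 1 / clique_degree (set cs) x)"
proof -
  let ?d = "\<lambda>x. real (clique_degree (set cs) x)"
  let ?g = "\<lambda>x. if x \<in> cs ! i \<inter> cs ! j then 1 / ?d x else 0"
  have "(transpose_mat (clique_incidence_matrix xs cs) * clique_incidence_matrix xs cs) $$ (i, j)
      = (\<Sum>l<length xs. ?g (xs ! l))"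
    using i j unfolding clique_incidence_matrix_def
    by (auto simp: scalar_prod_def lessThan_atLeast0 intro!: sum.cong)
  also have "\<dots> = sum ?g (set xs)" by (rule sum_nth_distinct[OF xs])
  also have "\<dots> = (\<Sum>x \<in> cs ! i \<inter> cs ! j. 1 / ?d x)"
    using sub by (subst sum.inter_restrict[symmetric]) (auto intro!: sum.cong)
  finally show ?thesis .
qed

locale clique_partition =
  fixes H :: "'b pair_pre_digraph" and k :: nat and C :: "'b set set"
  assumes finite_verts: "finite (pverts H)"
    and clique_size: "k \<ge> 2"
    and clique_card: "c \<in> C \<Longrightarrow> card c = k"
    and clique_verts: "c \<in> C \<Longrightarrow> c \<subseteq> pverts H"
    and covered: "x \<in> pverts H \<Longrightarrow> \<exists>c \<in> C. x \<in> c"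
    and arc_iff: "(x, y) \<in> parcs H \<longleftrightarrow> x \<noteq> y \<and> (\<exists>c \<in> C. x \<in> c \<and> y \<in> c)"
    and clique_unique: "\<lbrakk>c \<in> C; c' \<in> C; x \<in> c \<inter> c'; y \<in> c \<inter> c'; x \<noteq> y\<rbrakk> \<Longrightarrow> c = c'"
begin

lemma finite_cliques: "finite C"
  by (rule finite_subset[of _ "Pow (pverts H)"]) (use clique_verts finite_verts in auto)

lemma clique_degree_pos:
  assumes "x \<in> pverts H"
  shows "clique_degree C x > 0"
  using covered[OF assms] finite_cliques by (auto simp: clique_degree_def card_gt_0_iff)

lemma sym_arcs: "sym (parcs H)"
  by (auto intro!: symI simp: arc_iff)

text \<open>
  The neighbours of \<open>x\<close> split into the remainders of the cliques through \<open>x\<close>, which are disjoint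
  because two cliques share at most one vertex.
\<close>

lemma out_degree_eq: "out_degree (with_proj H) x = (k - 1) * clique_degree C x"
proof -
  let ?D = "{c \<in> C. x \<in> c}"
  have "{y. (x, y) \<in> parcs H} = (\<Union>c \<in> ?D. c - {x})"
    by (auto simp: arc_iff)
  moreover have "card \<dots> = (\<Sum>c \<in> ?D. card (c - {x}))"
  proof (intro card_UN_disjoint ballI impI)
    fix c c' assume "c \<in> ?D" "c' \<in> ?D" "c \<noteq> c'"
    then show "(c - {x}) \<inter> (c' - {x}) = {}" using clique_unique[of c c' x] by auto
  qed (use finite_cliques finite_subset[OF clique_verts finite_verts] in auto)
  moreover have "\<dots> = (\<Sum>c \<in> ?D. k - 1)"
    using clique_card by (intro sum.cong) auto
  ultimately show ?thesis
    by (simp add: out_degree_eq_card clique_degree_def)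
qed

lemma card_common_cliques:
  assumes "x \<noteq> y"
  shows "card {c \<in> C. x \<in> c \<and> y \<in> c} = (if (x, y) \<in> parcs H then 1 else 0)"
proof (cases "(x, y) \<in> parcs H")
  case True
  then obtain c where "c \<in> C" "x \<in> c" "y \<in> c" by (auto simp: arc_iff)
  then have "{c \<in> C. x \<in> c \<and> y \<in> c} = {c}"
    using clique_unique assms by blast
  then show ?thesis using True by simp
next
  case False
  then have "{c \<in> C. x \<in> c \<and> y \<in> c} = {}" using assms by (auto simp: arc_iff)
  then show ?thesis using False by (metis card.empty)
qed

text \<open>
  Up to weights, an off-diagonal entry of \<open>N N\<^sup>T\<close> counts the common cliques of two vertices; there is
  one if they are adjacent and none otherwise; a diagonal entry is 1 by the choice of weights.
  The factor \<open>1 - k\<close> compensates the ratio \<open>k - 1\<close> between degree and clique degree.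
\<close>

lemma incidence_times_transpose:
  assumes xs: "distinct xs" "set xs = pverts H" and cs: "distinct cs" "set cs = C"
  shows "clique_incidence_matrix xs cs * transpose_mat (clique_incidence_matrix xs cs)
    = real k \<cdot>\<^sub>m 1\<^sub>m (length xs) + (1 - real k) \<cdot>\<^sub>m normalized_laplacian H xs"
    (is "?N * _ = ?R")
proof (rule eq_matI)
  fix i j assume "i < dim_row ?R" "j < dim_col ?R"
  then have i: "i < length xs" and j: "j < length xs"
    by (simp_all add: normalized_laplacian_def)
  let ?x = "xs ! i" and ?y = "xs ! j"
  let ?d = "\<lambda>x. real (clique_degree C x)"
  have pos: "?d ?x > 0" "?d ?y > 0"
    using i j xs(2) clique_degree_pos nth_mem by (metis of_nat_0_less_iff)+
  let ?g = "\<lambda>c. if ?x \<in> c \<and> ?y \<in> c then 1 / sqrt (?d ?x * ?d ?y) else 0"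
  have "(?N * transpose_mat ?N) $$ (i, j) = (\<Sum>l<length cs. ?g (cs ! l))"
    using i j unfolding clique_incidence_matrix_def cs(2)
    by (auto simp: scalar_prod_def lessThan_atLeast0 real_sqrt_mult intro!: sum.cong)
  also have "\<dots> = sum ?g C" using sum_nth_distinct[OF cs(1), of ?g] cs(2) by simp
  also have "\<dots> = card {c \<in> C. ?x \<in> c \<and> ?y \<in> c} / sqrt (?d ?x * ?d ?y)"
    using finite_cliques by (simp add: sum.If_cases Int_def)
  finally have N: "(?N * transpose_mat ?N) $$ (i, j) = \<dots>" .
  have k: "real (k - Suc 0) = real k - 1" "real k - 1 > 0" using clique_size by auto
  have deg: "sqrt (real (out_degree (with_proj H) ?x) * real (out_degree (with_proj H) ?y))
      = (real k - 1) * sqrt (?d ?x * ?d ?y)"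
  proof -
    have "real (out_degree (with_proj H) ?x) * real (out_degree (with_proj H) ?y)
        = (real k - 1)\<^sup>2 * (?d ?x * ?d ?y)"
      by (simp add: out_degree_eq k power2_eq_square)
    then show ?thesis using k by (simp add: real_sqrt_mult)
  qed
  show "(?N * transpose_mat ?N) $$ (i, j) = ?R $$ (i, j)"
  proof (cases "i = j")
    case True
    have "(?x, ?x) \<notin> parcs H" by (simp add: arc_iff)
    moreover have "(?N * transpose_mat ?N) $$ (i, j) = 1"
      using pos N True by (simp add: clique_degree_def)
    ultimately show ?thesis
      using i True by (simp add: normalized_laplacian_def adjacency_matrix_def)
  next
    case False
    have neg: "(real k - 1) * z = (1 - real k) * (0 - z)" for z
      by (simp add: algebra_simps)
    from False have "?x \<noteq> ?y" using xs(1) i j by (simp add: nth_eq_iff_index_eq)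
    then have "(?N * transpose_mat ?N) $$ (i, j)
        = (if (?x, ?y) \<in> parcs H then 1 else 0) / sqrt (?d ?x * ?d ?y)"
      unfolding N by (simp add: card_common_cliques)
    also have "\<dots> = (real k - 1) * ((if (?x, ?y) \<in> parcs H then 1 else 0) /
        ((real k - 1) * sqrt (?d ?x * ?d ?y)))" (is "_ = _ * ?z")
      using k by simp
    also have "\<dots> = (1 - real k) * (0 - ?z)"
      by (rule neg)
    finally show ?thesis
      using i j False unfolding normalized_laplacian_def adjacency_matrix_def
      by (simp add: deg)
  qed
qed (simp_all add: clique_incidence_matrix_def normalized_laplacian_def)

text \<open>
  \<open>k I - (k - 1) L\<close> is a Gram matrix, hence positive semidefinite. For \<open>k = 2\<close> this is the classical
  bound 2 on the eigenvalues of a normalized Laplacian.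
\<close>

lemma eigenvalue_le:
  assumes xs: "distinct xs" "set xs = pverts H" and x: "x \<in># eig_mset (normalized_laplacian H xs)"
  shows "(real k - 1) * x \<le> k"
proof -
  obtain cs where cs: "set cs = C" "distinct cs"
    using finite_distinct_list[OF finite_cliques] by blast
  let ?N = "clique_incidence_matrix xs cs" and ?L = "normalized_laplacian H xs"
  let ?y = "real k + (1 - real k) * x"
  have "image_mset (\<lambda>e. real k + (1 - real k) * e) (eig_mset ?L) = eig_mset (?N * transpose_mat ?N)"
    unfolding incidence_times_transpose[OF xs cs(2,1)]
    using clique_size
    by (intro eig_mset_affine[symmetric] normalized_laplacian_symmetric sym_arcs) auto
  moreover have "?y \<in># image_mset (\<lambda>e. real k + (1 - real k) * e) (eig_mset ?L)"
    using x by auto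
  ultimately have "eigenvalue (?N * transpose_mat ?N) ?y"
    using eigenvalue_iff_in_eig_mset[OF mult_carrier_mat[of ?N "length xs" "length cs"]] by simp
  from gram_eigenvalue_nonneg[OF clique_incidence_matrix_carrier this]
  show ?thesis by (simp add: algebra_simps)
qed

end

lemma eig_mset_incidence_gram:
  assumes "clique_partition H k (set cs)" and xs: "distinct xs" "set xs = pverts H" and cs: "distinct cs"
  defines "N \<equiv> clique_incidence_matrix xs cs"
  shows "image_mset (\<lambda>x. real k + (1 - real k) * x) (eig_mset (normalized_laplacian H xs))
      + replicate_mset (length cs) 0
    = eig_mset (transpose_mat N * N) + replicate_mset (length xs) 0"
proof -
  interpret clique_partition H k "set cs" by fact
  have N: "N \<in> carrier_mat (length xs) (length cs)" unfolding N_def by simp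
  have "eig_mset (N * transpose_mat N)
      = image_mset (\<lambda>x. real k + (1 - real k) * x) (eig_mset (normalized_laplacian H xs))"
    unfolding N_def incidence_times_transpose[OF xs cs refl]
    using clique_size by (intro eig_mset_affine normalized_laplacian_symmetric sym_arcs) auto
  then show ?thesis
    using eig_mset_mult_commute[OF N, of "transpose_mat N"] N by simp
qed

section \<open>The Laplacian eigenvalues 0 and 2 of a connected graph\<close>

text \<open>
  For \<open>s = 1\<close> these are the functions constant on components, for \<open>s = -1\<close> those that change sign
  along every edge.
\<close>

definition signed_constant :: "'a pair_pre_digraph \<Rightarrow> real \<Rightarrow> ('a \<Rightarrow> real) \<Rightarrow> bool" where
  "signed_constant G s f \<longleftrightarrow> (\<forall>(u, w) \<in> parcs G. f w = s * f u)"

lemma connected_propagate: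
  assumes G: "pair_graph G" and conn: "connected (with_proj G)"
    and u: "u \<in> pverts G" and w: "w \<in> pverts G" and "P u"
    and step: "\<And>x y. (x, y) \<in> parcs G \<Longrightarrow> P x \<Longrightarrow> P y"
  shows "P w"
proof -
  interpret pair_graph G by fact
  have "strongly_connected (with_proj G)"
    using symmetric_connected_imp_strongly_connected[OF pair_sym_arcs conn] .
  then have "u \<rightarrow>\<^sup>*\<^bsub>with_proj G\<^esub> w" using u w by auto
  then have "(u, w) \<in> (parcs G)\<^sup>*" using reachable_rtranclI by fastforce
  then show ?thesis by (induction rule: rtrancl_induct) (use \<open>P u\<close> step in auto)
qed

lemma signed_constant_proportional:
  assumes G: "pair_graph G" and conn: "connected (with_proj G)"
    and f: "signed_constant G s f" and g: "signed_constant G s g"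
    and u: "u \<in> pverts G" and w: "w \<in> pverts G"
  shows "g w * f u = f w * g u"
proof (rule connected_propagate[OF G conn u w, where P = "\<lambda>w. g w * f u = f w * g u"])
  fix x y assume "(x, y) \<in> parcs G" and eq: "g x * f u = f x * g u"
  then have "f y = s * f x" "g y = s * g x"
    using f g by (auto simp: signed_constant_def)
  then show "g y * f u = f y * g u" using eq by simp
qed simp

lemma normalized_laplacian_mult_vec:
  assumes vs: "distinct vs" "set vs = pverts G"
    and pos: "\<forall>u \<in> pverts G. out_degree (with_proj G) u > 0"
    and i: "i < length vs"
  shows "(normalized_laplacian G vs *\<^sub>v
        vec (length vs) (\<lambda>i. sqrt (out_degree (with_proj G) (vs ! i)) * f (vs ! i))) $ i
    = sqrt (out_degree (with_proj G) (vs ! i)) * f (vs ! i)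
      - (\<Sum>w \<in> pverts G. if (vs ! i, w) \<in> parcs G then f w else 0)
        / sqrt (out_degree (with_proj G) (vs ! i))"
proof -
  let ?d = "\<lambda>u. real (out_degree (with_proj G) u)"
  let ?u = "vs ! i"
  let ?a = "\<lambda>w. if (?u, w) \<in> parcs G then f w else 0"
  have d: "?d (vs ! j) > 0" if "j < length vs" for j
    using that vs(2) pos nth_mem by (metis of_nat_0_less_iff)
  have dz [simp]: "out_degree (with_proj G) (vs ! j) \<noteq> 0" if "j < length vs" for j
    using d[OF that] by simp
  have "(normalized_laplacian G vs *\<^sub>v vec (length vs) (\<lambda>i. sqrt (?d (vs ! i)) * f (vs ! i))) $ i
      = (\<Sum>j<length vs. (if i = j then sqrt (?d (vs ! j)) * f (vs ! j) else 0)
          - ?a (vs ! j) / sqrt (?d ?u))"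
    using i unfolding normalized_laplacian_def adjacency_matrix_def
    by (auto simp: scalar_prod_def lessThan_atLeast0 real_sqrt_mult left_diff_distrib
        intro!: sum.cong)
  also have "\<dots> = sqrt (?d ?u) * f ?u - (\<Sum>j<length vs. ?a (vs ! j)) / sqrt (?d ?u)"
    using i by (simp add: sum_subtractf sum_divide_distrib)
  also have "(\<Sum>j<length vs. ?a (vs ! j)) = sum ?a (pverts G)"
    using sum_nth_distinct[OF vs(1), of ?a] vs(2) by simp
  finally show ?thesis .
qed

lemma sum_neighbours_const:
  assumes "pair_graph G"
  shows "(\<Sum>w \<in> pverts G. if (u, w) \<in> parcs G then c else 0) = out_degree (with_proj G) u * (c :: real)"
proof -
  interpret pair_graph G by fact
  have "pverts G \<inter> {w. (u, w) \<in> parcs G} = {w. (u, w) \<in> parcs G}" using in_arcsD2 by auto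
  then show ?thesis
    using pair_finite_verts by (simp add: sum.If_cases out_degree_eq_card)
qed

text \<open>
  Summing \<open>(f w - s f u)\<^sup>2\<close> over all arcs \<open>(u, w)\<close> and expanding, the two square terms give
  \<open>\<Sum>u. d(u) f(u)\<^sup>2\<close> each, and the hypothesis turns the mixed term into minus twice this sum.
  So every summand vanishes.
\<close>

lemma signed_constant_if_neighbour_sums:
  fixes f :: "'a \<Rightarrow> real" and s :: real
  assumes G: "pair_graph G" and s: "s\<^sup>2 = 1"
    and nb: "\<And>u. u \<in> pverts G \<Longrightarrow>
      (\<Sum>w \<in> pverts G. if (u, w) \<in> parcs G then f w else 0) = s * out_degree (with_proj G) u * f u"
  shows "signed_constant G s f"
proof -
  interpret pair_graph G by fact
  let ?V = "pverts G" and ?d = "\<lambda>u. real (out_degree (with_proj G) u)"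
  let ?a = "\<lambda>u w. if (u, w) \<in> parcs G then 1 else (0 :: real)"
  have sym: "?a u w = ?a w u" for u w
    using pair_sym_arcs by (auto simp: symmetric_def dest: symD)
  have deg: "(\<Sum>w\<in>?V. ?a u w) = ?d u" for u
    using sum_neighbours_const[OF G, of u 1] by simp
  have nb': "(\<Sum>w\<in>?V. ?a u w * f w) = s * ?d u * f u" if "u \<in> ?V" for u
    unfolding nb[OF that, symmetric] by (intro sum.cong) auto
  have "(\<Sum>u\<in>?V. \<Sum>w\<in>?V. ?a u w * (f w - s * f u)\<^sup>2)
      = (\<Sum>u\<in>?V. \<Sum>w\<in>?V. ?a u w * (f w)\<^sup>2) - (\<Sum>u\<in>?V. 2 * s * f u * (\<Sum>w\<in>?V. ?a u w * f w))
        + (\<Sum>u\<in>?V. s\<^sup>2 * (f u)\<^sup>2 * (\<Sum>w\<in>?V. ?a u w))"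
    unfolding sum_distrib_left sum.distrib[symmetric] sum_subtractf[symmetric]
    by (intro sum.cong refl) (auto simp: power2_eq_square algebra_simps)
  also have "(\<Sum>u\<in>?V. \<Sum>w\<in>?V. ?a u w * (f w)\<^sup>2) = (\<Sum>w\<in>?V. (f w)\<^sup>2 * (\<Sum>u\<in>?V. ?a w u))"
    unfolding sum_distrib_left by (subst sum.swap) (simp add: sym mult.commute)
  also have "\<dots> = (\<Sum>u\<in>?V. ?d u * (f u)\<^sup>2)" by (simp only: deg mult.commute)
  also have "(\<Sum>u\<in>?V. 2 * s * f u * (\<Sum>w\<in>?V. ?a u w * f w)) = (\<Sum>u\<in>?V. 2 * (?d u * (f u)\<^sup>2))"
  proof (intro sum.cong refl)
    fix u assume "u \<in> ?V"
    then have "2 * s * f u * (\<Sum>w\<in>?V. ?a u w * f w) = 2 * s\<^sup>2 * ?d u * (f u)\<^sup>2"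
      by (simp only: nb') (simp add: power2_eq_square)
    then show "2 * s * f u * (\<Sum>w\<in>?V. ?a u w * f w) = 2 * (?d u * (f u)\<^sup>2)" using s by simp
  qed
  also have "(\<Sum>u\<in>?V. s\<^sup>2 * (f u)\<^sup>2 * (\<Sum>w\<in>?V. ?a u w)) = (\<Sum>u\<in>?V. ?d u * (f u)\<^sup>2)"
    by (simp only: deg s) (simp add: mult.commute)
  finally have "(\<Sum>u\<in>?V. \<Sum>w\<in>?V. ?a u w * (f w - s * f u)\<^sup>2) = 0"
    by (simp add: sum_distrib_left[symmetric])
  then have zero: "?a u w * (f w - s * f u)\<^sup>2 = 0" if "u \<in> ?V" "w \<in> ?V" for u w
    using that pair_finite_verts
    by (simp add: sum_nonneg_eq_0_iff sum_nonneg)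
  show ?thesis
    unfolding signed_constant_def using zero in_arcsD1 in_arcsD2 by fastforce
qed

text \<open>
  Dividing the entry of \<open>v\<close> at a vertex by the square root of the degree turns the eigenvalue
  equation into the statement that the values on the neighbours of \<open>u\<close> add up to \<open>s d(u) f(u)\<close>.
\<close>

lemma eigenvector_signed_constant:
  assumes G: "pair_graph G" and vs: "distinct vs" "set vs = pverts G"
    and pos: "\<forall>u \<in> pverts G. out_degree (with_proj G) u > 0"
    and s: "s\<^sup>2 = 1"
  shows "eigenvector (normalized_laplacian G vs) v (1 - s) \<longleftrightarrow>
    (\<exists>f. v = vec (length vs) (\<lambda>i. sqrt (out_degree (with_proj G) (vs ! i)) * f (vs ! i))
      \<and> signed_constant G s f \<and> (\<exists>u \<in> pverts G. f u \<noteq> 0))"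
proof -
  interpret pair_graph G by fact
  let ?d = "\<lambda>u. real (out_degree (with_proj G) u)"
  let ?N = "length vs" and ?L = "normalized_laplacian G vs"
  let ?vec = "\<lambda>f. vec ?N (\<lambda>i. sqrt (?d (vs ! i)) * f (vs ! i))"
  have d: "?d (vs ! i) > 0" if "i < ?N" for i
    using that vs(2) pos nth_mem by (metis of_nat_0_less_iff)
  have nz: "?vec f = 0\<^sub>v ?N \<longleftrightarrow> (\<forall>u \<in> pverts G. f u = 0)" for f
  proof -
    have "?vec f = 0\<^sub>v ?N \<longleftrightarrow> (\<forall>i<?N. f (vs ! i) = 0)"
      using d by (auto simp: vec_eq_iff) force+
    also have "\<dots> \<longleftrightarrow> (\<forall>u \<in> set vs. f u = 0)" by (simp add: all_set_conv_all_nth)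
    finally show ?thesis by (simp only: vs(2))
  qed
  have eig: "?L *\<^sub>v ?vec f = (1 - s) \<cdot>\<^sub>v ?vec f \<longleftrightarrow> signed_constant G s f" for f
  proof -
    let ?S = "\<lambda>u. \<Sum>w \<in> pverts G. if (u, w) \<in> parcs G then f w else 0"
    have "?L *\<^sub>v ?vec f = (1 - s) \<cdot>\<^sub>v ?vec f \<longleftrightarrow>
        (\<forall>i<?N. (?L *\<^sub>v ?vec f) $ i = (1 - s) * (sqrt (?d (vs ! i)) * f (vs ! i)))"
      by (auto simp: vec_eq_iff normalized_laplacian_def)
    also have "\<dots> \<longleftrightarrow> (\<forall>i<?N. ?S (vs ! i) = s * ?d (vs ! i) * f (vs ! i))"
    proof (intro all_cong)
      fix i assume i: "i < ?N"
      have "sqrt (?d (vs ! i)) * sqrt (?d (vs ! i)) = ?d (vs ! i)" by simp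
      then show "(?L *\<^sub>v ?vec f) $ i = (1 - s) * (sqrt (?d (vs ! i)) * f (vs ! i)) \<longleftrightarrow>
          ?S (vs ! i) = s * ?d (vs ! i) * f (vs ! i)"
        unfolding normalized_laplacian_mult_vec[OF vs pos i] using d[OF i]
        by (auto simp: field_simps)
    qed
    also have "\<dots> \<longleftrightarrow> (\<forall>u \<in> set vs. ?S u = s * ?d u * f u)"
      by (simp add: all_set_conv_all_nth)
    also have "\<dots> \<longleftrightarrow> (\<forall>u \<in> pverts G. ?S u = s * ?d u * f u)"
      by (simp only: vs(2))
    also have "\<dots> \<longleftrightarrow> signed_constant G s f"
    proof
      assume sc: "signed_constant G s f"
      have "?S u = (\<Sum>w \<in> pverts G. if (u, w) \<in> parcs G then s * f u else 0)" for u
        using sc by (intro sum.cong) (auto simp: signed_constant_def)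
      then show "\<forall>u \<in> pverts G. ?S u = s * ?d u * f u"
        by (simp add: sum_neighbours_const[OF G])
    qed (use signed_constant_if_neighbour_sums[OF G s] in blast)
    finally show ?thesis .
  qed
  have ex_vec: "\<exists>f. v = ?vec f" if "v \<in> carrier_vec ?N"
  proof -
    have inj: "inj_on ((!) vs) {..<?N}" using vs(1) by (simp add: inj_on_def nth_eq_iff_index_eq)
    let ?f = "\<lambda>u. v $ (inv_into {..<?N} ((!) vs) u) / sqrt (?d u)"
    have "v = ?vec ?f"
      using that d by (intro eq_vecI) (simp_all add: inv_into_f_f[OF inj] less_imp_neq[symmetric])
    then show ?thesis by (rule exI[of _ ?f])
  qed
  have dim: "dim_row ?L = ?N" by (simp add: normalized_laplacian_def)
  show ?thesis
  proof
    assume ev: "eigenvector ?L v (1 - s)"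
    then obtain f where v: "v = ?vec f"
      using ex_vec unfolding eigenvector_def dim by blast
    have "signed_constant G s f" "\<exists>u \<in> pverts G. f u \<noteq> 0"
      using ev eig[of f] nz[of f] unfolding eigenvector_def dim v by simp_all
    then show "\<exists>f. v = ?vec f \<and> signed_constant G s f \<and> (\<exists>u \<in> pverts G. f u \<noteq> 0)"
      using v by blast
  next
    assume "\<exists>f. v = ?vec f \<and> signed_constant G s f \<and> (\<exists>u \<in> pverts G. f u \<noteq> 0)"
    then obtain f where v: "v = ?vec f" and "signed_constant G s f" "\<exists>u \<in> pverts G. f u \<noteq> 0"
      by blast
    then show "eigenvector ?L v (1 - s)"
      using eig[of f] nz[of f] unfolding eigenvector_def dim v by simp
  qed
qed

lemma eig_mult_signed_constant:
  assumes G: "pair_graph G" and conn: "connected (with_proj G)"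
    and vs: "distinct vs" "set vs = pverts G"
    and pos: "\<forall>u \<in> pverts G. out_degree (with_proj G) u > 0"
    and s: "s\<^sup>2 = 1"
  shows "eig_mult (normalized_laplacian G vs) (1 - s)
    = (if \<exists>f. signed_constant G s f \<and> (\<exists>u \<in> pverts G. f u \<noteq> 0) then 1 else 0)"
proof -
  interpret pair_graph G by fact
  let ?d = "\<lambda>u. real (out_degree (with_proj G) u)"
  let ?L = "normalized_laplacian G vs"
  have L: "?L \<in> carrier_mat (length vs) (length vs)" by simp
  have "sym (parcs G)" using pair_sym_arcs by (simp add: symmetric_def)
  note sym = normalized_laplacian_symmetric[OF this]
  note ev = eigenvector_signed_constant[OF G vs pos s]
  have "eig_mult ?L (1 - s) \<le> 1"
  proof (rule symmetric_simple_eigenvalue[OF L sym])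
    fix v w assume v_ev: "eigenvector ?L v (1 - s)" and w_ev: "eigenvector ?L w (1 - s)"
    from v_ev obtain f u where v: "v = vec (length vs) (\<lambda>i. sqrt (?d (vs ! i)) * f (vs ! i))"
      and f: "signed_constant G s f" and u: "u \<in> pverts G" "f u \<noteq> 0"
      unfolding ev by auto
    from w_ev obtain g where w: "w = vec (length vs) (\<lambda>i. sqrt (?d (vs ! i)) * g (vs ! i))"
      and g: "signed_constant G s g"
      unfolding ev by auto
    have "g x = g u / f u * f x" if "x \<in> pverts G" for x
      using signed_constant_proportional[OF G conn f g u(1) that] u(2)
      by (simp add: field_simps)
    moreover have "vs ! i \<in> pverts G" if "i < length vs" for i
      using that vs(2) nth_mem by metis
    ultimately have "w = (g u / f u) \<cdot>\<^sub>v v"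
      unfolding v w by (intro eq_vecI) auto
    then show "\<exists>c. w = c \<cdot>\<^sub>v v" by blast
  qed
  moreover have "eig_mult ?L (1 - s) > 0 \<longleftrightarrow> (\<exists>v. eigenvector ?L v (1 - s))"
    using eigenvalue_iff_in_eig_mset[OF L] count_eig_mset[OF L]
    unfolding eigenvalue_def by (metis count_greater_zero_iff)
  ultimately show ?thesis unfolding ev by auto
qed

text \<open>
  A bipartition is the same as a sign pattern alternating along the edges, and on a
  connected graph a nonzero alternating function vanishes nowhere.
\<close>

lemma bipartite_iff_signed_constant:
  assumes G: "pair_graph G" and conn: "connected (with_proj G)"
  shows "bipartite G \<longleftrightarrow> (\<exists>f. signed_constant G (- 1) f \<and> (\<exists>u \<in> pverts G. f u \<noteq> 0))"
proof
  assume "bipartite G"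
  then obtain U W where UW: "U \<union> W = pverts G" "U \<inter> W = {}"
    "\<forall>(u, v) \<in> parcs G. (u \<in> U \<and> v \<in> W) \<or> (u \<in> W \<and> v \<in> U)"
    unfolding bipartite_def by blast
  have "signed_constant G (- 1) (\<lambda>u. if u \<in> U then 1 else - 1)"
    unfolding signed_constant_def using UW by fastforce
  moreover have "pverts G \<noteq> {}" using conn by (simp add: connected_conv)
  ultimately show "\<exists>f. signed_constant G (- 1) f \<and> (\<exists>u \<in> pverts G. f u \<noteq> 0)"
    by (intro exI[of _ "\<lambda>u. if u \<in> U then 1 else - 1"]) auto
next
  assume "\<exists>f. signed_constant G (- 1) f \<and> (\<exists>u \<in> pverts G. f u \<noteq> 0)"
  then obtain f u where f: "signed_constant G (- 1) f" and u: "u \<in> pverts G" "f u \<noteq> 0" by blast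
  interpret pair_graph G by fact
  have neg: "f y = - f x" if "(x, y) \<in> parcs G" for x y
    using f that by (auto simp: signed_constant_def)
  have nz: "f w \<noteq> 0" if "w \<in> pverts G" for w
    by (rule connected_propagate[OF G conn u(1) that, where P = "\<lambda>w. f w \<noteq> 0"])
       (use u(2) neg in auto)
  show "bipartite G"
    unfolding bipartite_def
  proof (intro exI conjI)
    show "{w \<in> pverts G. f w > 0} \<union> {w \<in> pverts G. f w < 0} = pverts G"
      using nz by (auto simp: neq_iff)
    show "{w \<in> pverts G. f w > 0} \<inter> {w \<in> pverts G. f w < 0} = {}" by auto
    show "\<forall>(x, y) \<in> parcs G.
        (x \<in> {w \<in> pverts G. f w > 0} \<and> y \<in> {w \<in> pverts G. f w < 0}) \<or>
        (x \<in> {w \<in> pverts G. f w < 0} \<and> y \<in> {w \<in> pverts G. f w > 0})"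
    proof clarify
      fix x y assume a: "(x, y) \<in> parcs G"
        and b: "\<not> (x \<in> {w \<in> pverts G. f w < 0} \<and> y \<in> {w \<in> pverts G. f w > 0})"
      note xy = in_arcsD1[OF a] in_arcsD2[OF a]
      then show "x \<in> {w \<in> pverts G. f w > 0} \<and> y \<in> {w \<in> pverts G. f w < 0}"
        using b nz neg[OF a] by (cases "f x > 0") (auto simp: neq_iff)
    qed
  qed
qed

section \<open>Cliques of a graph and of its blow-up\<close>

lemma edges_finite: "pair_graph G \<Longrightarrow> finite (edges G)"
proof -
  assume "pair_graph G"
  then interpret pair_graph G .
  show ?thesis using pair_finite_arcs by (simp add: edges_def)
qed

lemma edge_arcs:
  assumes "pair_graph G"
  shows "(x, y) \<in> parcs G \<longleftrightarrow> x \<noteq> y \<and> (\<exists>e \<in> edges G. x \<in> e \<and> y \<in> e)"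
proof -
  interpret pair_graph G by fact
  have "(x, y) \<in> parcs G \<longleftrightarrow> (y, x) \<in> parcs G" for x y
    using pair_sym_arcs by (auto simp: symmetric_def dest: symD)
  then show ?thesis
    using pair_no_loops[of "(x, y)"] unfolding edges_def by fastforce
qed

lemma edge_card:
  assumes "pair_graph G" and "e \<in> edges G"
  shows "card e = 2" and "e \<subseteq> pverts G"
proof -
  interpret pair_graph G by fact
  show "card e = 2" "e \<subseteq> pverts G"
    using assms(2) pair_no_loops in_arcsD1 in_arcsD2 by (fastforce simp: edges_def)+
qed

lemma edge_unique:
  assumes "pair_graph G" and "e \<in> edges G" "e' \<in> edges G"
    and "x \<in> e \<inter> e'" "y \<in> e \<inter> e'" "x \<noteq> y"
  shows "e = e'"
proof -
  have "e = {x, y}" "e' = {x, y}"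
    using edge_card(1)[OF assms(1)] assms(2-) by (auto simp: card_2_iff)
  then show ?thesis by simp
qed

lemma vertex_on_edge:
  assumes G: "pair_graph G" and conn: "connected (with_proj G)" and ne: "edges G \<noteq> {}"
    and u: "u \<in> pverts G"
  shows "\<exists>e \<in> edges G. u \<in> e"
proof -
  obtain x y where "(x, y) \<in> parcs G" using ne by (auto simp: edges_def)
  then have "\<exists>e \<in> edges G. x \<in> e" "x \<in> pverts G"
    using edge_arcs[OF G] edge_card(2)[OF G] by blast+
  then show ?thesis
    using connected_propagate[OF G conn, of x u "\<lambda>u. \<exists>e \<in> edges G. u \<in> e"] u edge_arcs[OF G] by blast
qed

lemma clique_partition_edges:
  assumes G: "pair_graph G" and conn: "connected (with_proj G)" and ne: "edges G \<noteq> {}"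
  shows "clique_partition G 2 (edges G)"
proof -
  interpret pair_graph G by fact
  show ?thesis
    by unfold_locales
      (use pair_finite_verts edge_card[OF G] vertex_on_edge[OF G conn ne] edge_arcs[OF G]
        edge_unique[OF G] in auto)
qed

lemma Old_in_clique_of [simp]: "Old u \<in> clique_of n e \<longleftrightarrow> u \<in> e"
  by (auto simp: clique_of_def)

lemma New_in_clique_of [simp]: "New f i \<in> clique_of n e \<longleftrightarrow> f = e \<and> i \<in> {1..n - 2}"
  by (auto simp: clique_of_def)

lemma clique_of_eq_iff [simp]: "clique_of n e = clique_of n f \<longleftrightarrow> e = f"
  by (metis Old_in_clique_of subsetI subset_antisym)

lemma clique_partition_blowup:
  assumes G: "pair_graph G" and conn: "connected (with_proj G)" and ne: "edges G \<noteq> {}"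
    and n: "n \<ge> 2"
  shows "clique_partition (clique_blowup n G) n (clique_of n ` edges G)"
proof -
  interpret pair_graph G by fact
  show ?thesis
  proof
    show "finite (pverts (clique_blowup n G))"
      using pair_finite_verts edges_finite[OF G] by (simp add: clique_blowup_def)
    show "card c = n" if c: "c \<in> clique_of n ` edges G" for c
    proof -
      obtain e where e: "e \<in> edges G" "c = clique_of n e" using c by blast
      have c2: "card e = 2" using edge_card(1)[OF G e(1)] .
      then have "finite e" using card.infinite by fastforce
      then have "card (clique_of n e) = card (Old ` e) + card (New e ` {1..n - 2})"
        unfolding clique_of_def by (intro card_Un_disjoint) auto
      then show ?thesis using c2 n e(2) by (simp add: card_image inj_on_def)
    qed
    show "c \<subseteq> pverts (clique_blowup n G)" if "c \<in> clique_of n ` edges G" for c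
      using that edge_card(2)[OF G] by (auto simp: clique_blowup_def clique_of_def)
    show "\<exists>c \<in> clique_of n ` edges G. x \<in> c" if "x \<in> pverts (clique_blowup n G)" for x
      using that vertex_on_edge[OF G conn ne] by (auto simp: clique_blowup_def)
    show "c = c'" if c: "c \<in> clique_of n ` edges G" "c' \<in> clique_of n ` edges G"
      and xy: "x \<in> c \<inter> c'" "y \<in> c \<inter> c'" "x \<noteq> y" for c c' x y
    proof -
      obtain e e' where e: "e \<in> edges G" "e' \<in> edges G" "c = clique_of n e" "c' = clique_of n e'"
        using c by blast
      have "e = e'"
        using xy edge_unique[OF G e(1,2)] unfolding e(3,4) by (cases x; cases y) auto
      then show ?thesis using e by simp
    qed
  qed (use n in \<open>auto simp: clique_blowup_def\<close>)
qed

lemma clique_degree_blowup_Old: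
  "clique_degree (clique_of n ` E) (Old u) = clique_degree E u"
proof -
  have "{c \<in> clique_of n ` E. Old u \<in> c} = clique_of n ` {e \<in> E. u \<in> e}" by auto
  then show ?thesis by (simp add: clique_degree_def card_image inj_on_def)
qed

lemma clique_degree_blowup_New:
  assumes "e \<in> E" "i \<in> {1..n - 2}"
  shows "clique_degree (clique_of n ` E) (New e i) = 1"
proof -
  have "{c \<in> clique_of n ` E. New e i \<in> c} = {clique_of n e}" using assms by auto
  then show ?thesis by (simp add: clique_degree_def)
qed

text \<open>
  Two distinct cliques of the blow-up meet only in old vertices, where their edges meet, and an
  old vertex lies in as many cliques as it lies on edges. The \<open>n - 2\<close> new vertices of a clique
  have clique degree 1.
\<close>

lemma blowup_gram:
  assumes G: "pair_graph G" and n: "n \<ge> 2"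
    and vs: "distinct vs" "set vs = pverts G" and es: "set es = edges G" "distinct es"
    and ws: "distinct ws" "set ws = pverts (clique_blowup n G)"
  defines "M \<equiv> clique_incidence_matrix ws (map (clique_of n) es)"
    and "R \<equiv> clique_incidence_matrix vs es"
  shows "transpose_mat M * M = (real n - 2) \<cdot>\<^sub>m 1\<^sub>m (length es) + 1 \<cdot>\<^sub>m (transpose_mat R * R)"
    (is "_ = ?rhs")
proof (rule eq_matI)
  fix i j assume "i < dim_row ?rhs" "j < dim_col ?rhs"
  then have ij: "i < length es" "j < length es"
    by (simp_all add: R_def clique_incidence_matrix_def)
  let ?e = "es ! i" and ?f = "es ! j" and ?C = "clique_of n ` edges G"
  have e: "?e \<in> edges G" and f: "?f \<in> edges G" using ij es(1) nth_mem by blast+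
  have sub: "clique_of n ?e \<subseteq> set ws"
    using e edge_card(2)[OF G] ws(2) by (auto simp: clique_blowup_def clique_of_def)
  have fin: "finite ?e" using edge_card(1)[OF G e] card.infinite by fastforce
  have "(transpose_mat M * M) $$ (i, j)
      = (\<Sum>x \<in> clique_of n ?e \<inter> clique_of n ?f. 1 / clique_degree ?C x)"
    using clique_incidence_gram[OF ws(1), of i "map (clique_of n) es" j] ij sub es(1)
    unfolding M_def by simp
  also have "clique_of n ?e \<inter> clique_of n ?f
      = Old ` (?e \<inter> ?f) \<union> (if i = j then New ?e ` {1..n - 2} else {})"
    using ij es(2) by (auto simp: clique_of_def nth_eq_iff_index_eq)
  also have "(\<Sum>x \<in> \<dots>. 1 / real (clique_degree ?C x))
      = (\<Sum>x \<in> Old ` (?e \<inter> ?f). 1 / real (clique_degree ?C x))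
        + (\<Sum>x \<in> (if i = j then New ?e ` {1..n - 2} else {}). 1 / real (clique_degree ?C x))"
    using fin by (intro sum.union_disjoint) auto
  also have "(\<Sum>x \<in> Old ` (?e \<inter> ?f). 1 / real (clique_degree ?C x))
      = (\<Sum>u \<in> ?e \<inter> ?f. 1 / real (clique_degree (edges G) u))"
    by (subst sum.reindex) (auto simp: inj_on_def clique_degree_blowup_Old)
  also have "\<dots> = (transpose_mat R * R) $$ (i, j)"
    using clique_incidence_gram[OF vs(1) ij(1,2)] edge_card(2)[OF G e] vs(2) es(1)
    unfolding R_def by simp
  also have "(\<Sum>x \<in> (if i = j then New ?e ` {1..n - 2} else {}). 1 / real (clique_degree ?C x))
      = (if i = j then real n - 2 else 0)"
  proof -
    have "(\<Sum>x \<in> New ?e ` {1..n - 2}. 1 / real (clique_degree ?C x)) = (\<Sum>x \<in> New ?e ` {1..n - 2}. 1)"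
      using clique_degree_blowup_New[OF e] by (intro sum.cong) auto
    then have "(\<Sum>x \<in> New ?e ` {1..n - 2}. 1 / real (clique_degree ?C x)) = real n - 2"
      using n by (simp add: card_image inj_on_def of_nat_diff)
    then show ?thesis by (cases "i = j") (simp_all only: if_True if_False sum.empty simp_thms)
  qed
  finally show "(transpose_mat M * M) $$ (i, j) = ?rhs $$ (i, j)"
    using ij by (simp add: R_def clique_incidence_matrix_def)
qed (simp_all add: M_def R_def clique_incidence_matrix_def)

lemma card_blowup_verts:
  assumes "pair_graph G"
  shows "card (pverts (clique_blowup n G)) = card (pverts G) + (n - 2) * card (edges G)"
proof -
  interpret pair_graph G by fact
  have fin: "finite (edges G)" by (rule edges_finite[OF assms])
  have "card (pverts (clique_blowup n G))
      = card (Old ` pverts G) + card (\<Union>e \<in> edges G. New e ` {1..n - 2})"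
    unfolding clique_blowup_def pair_pre_digraph.select_convs
    using fin pair_finite_verts by (intro card_Un_disjoint) auto
  also have "card (\<Union>e \<in> edges G. New e ` {1..n - 2}) = (\<Sum>e \<in> edges G. card (New e ` {1..n - 2}))"
    using fin by (intro card_UN_disjoint) auto
  also have "\<dots> = (n - 2) * card (edges G)"
    by (simp add: card_image inj_on_def)
  finally show ?thesis by (simp add: card_image inj_on_def)
qed

section \<open>The spectrum of the blow-up\<close>

lemma eig_mset_laplacian_split:
  assumes G: "pair_graph G" and conn: "connected (with_proj G)" and ne: "edges G \<noteq> {}"
    and vs: "distinct vs" "set vs = pverts G"
  defines "LG \<equiv> normalized_laplacian G vs"
  shows "eig_mset LG = {#0#} + filter_mset (\<lambda>x. x \<noteq> 0 \<and> x \<noteq> 2) (eig_mset LG)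
    + replicate_mset (if bipartite G then 1 else 0) 2"
proof -
  interpret clique_partition G 2 "edges G" by (rule clique_partition_edges[OF G conn ne])
  have pos: "\<forall>u \<in> pverts G. out_degree (with_proj G) u > 0"
    using clique_degree_pos by (simp add: out_degree_eq)
  note mult = eig_mult_signed_constant[OF G conn vs pos, folded LG_def]
  have "\<exists>f. signed_constant G 1 f \<and> (\<exists>u \<in> pverts G. f u \<noteq> 0)"
    using conn by (intro exI[of _ "\<lambda>_. 1"]) (auto simp: signed_constant_def connected_conv)
  then have "eig_mult LG 0 = 1" using mult[of 1] by simp
  moreover have "eig_mult LG 2 = (if bipartite G then 1 else 0)"
    using mult[of "- 1"] bipartite_iff_signed_constant[OF G conn] by simp
  ultimately have "count (eig_mset LG) 0 = 1"
    "count (eig_mset LG) 2 = (if bipartite G then 1 else 0)"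
    using count_eig_mset[of LG "length vs"] by (simp_all add: LG_def)
  then show ?thesis by (intro multiset_eqI) (auto simp: not_in_iff)
qed

text \<open>
  The blocks of equal eigenvalues added on either side are the images of the zeros by which the
  spectra of \<open>N N\<^sup>T\<close> and \<open>N\<^sup>T N\<close> differ. They stand on both sides because which of
  the numbers of vertices and edges is larger depends on \<open>G\<close>.
\<close>

lemma blowup_spectrum_balance:
  assumes G: "pair_graph G" and conn: "connected (with_proj G)" and ne: "edges G \<noteq> {}"
    and n: "n \<ge> 2"
    and vs: "distinct vs" "set vs = pverts G"
    and ws: "distinct ws" "set ws = pverts (clique_blowup n G)"
  defines "LG \<equiv> normalized_laplacian G vs"
    and "LC \<equiv> normalized_laplacian (clique_blowup n G) ws"
  shows "eig_mset LC + replicate_mset (card (edges G)) (real n / (real n - 1))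
      + replicate_mset (card (pverts G)) (2 / (real n - 1))
    = image_mset (\<lambda>x. x / (real n - 1)) (eig_mset LG)
      + replicate_mset (card (edges G)) (2 / (real n - 1))
      + replicate_mset (card (pverts (clique_blowup n G))) (real n / (real n - 1))"
proof -
  obtain es where es: "set es = edges G" "distinct es"
    using finite_distinct_list[OF edges_finite[OF G]] by blast
  have len: "length vs = card (pverts G)" "length es = card (edges G)"
    "length ws = card (pverts (clique_blowup n G))"
    using vs es ws by (metis distinct_card)+
  define R where "R = clique_incidence_matrix vs es"
  define M where "M = clique_incidence_matrix ws (map (clique_of n) es)"
  let ?RR = "transpose_mat R * R" and ?MM = "transpose_mat M * M"
  have R: "R \<in> carrier_mat (length vs) (length es)" by (simp add: R_def)
  have edge_spec: "image_mset (\<lambda>x. 2 - x) (eig_mset LG) + replicate_mset (length es) 0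
      = eig_mset ?RR + replicate_mset (length vs) 0"
    using eig_mset_incidence_gram[of G 2 es vs] clique_partition_edges[OF G conn ne] es vs
    unfolding R_def LG_def by simp
  have "distinct (map (clique_of n) es)" using es(2) by (simp add: distinct_map inj_on_def)
  then have clique_spec: "image_mset (\<lambda>x. real n + (1 - real n) * x) (eig_mset LC)
      + replicate_mset (length es) 0 = eig_mset ?MM + replicate_mset (length ws) 0"
    using eig_mset_incidence_gram[of "clique_blowup n G" n "map (clique_of n) es" ws]
      clique_partition_blowup[OF G conn ne n] es(1) ws
    unfolding M_def LC_def by simp
  have "transpose_mat ?RR = ?RR"
    using R by (simp add: transpose_mult[of _ "length es" "length vs" _ "length es"])
  then have shift: "eig_mset ?MM = image_mset (\<lambda>y. real n - 2 + y) (eig_mset ?RR)"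
    using eig_mset_affine[of ?RR "length es" 1 "real n - 2"] R
      blowup_gram[OF G n vs es ws]
    unfolding M_def R_def by simp
  have n1: "real n - 1 \<noteq> 0" using n by simp
  let ?p = "\<lambda>y. (real n - y) / (real n - 1)" and ?q = "\<lambda>y. (2 - y) / (real n - 1)"
  \<comment> \<open>\<open>?p\<close> undoes the passage from the Laplacian of the blow-up to \<open>M * transpose_mat M\<close>.\<close>
  have pLC: "?p (real n + (1 - real n) * x) = x" for x
    using n1 by (simp add: field_simps)
  have pshift: "?p (real n - 2 + y) = ?q y" for y by simp
  have qLG: "?q (2 - x) = x / (real n - 1)" for x by simp
  have C: "eig_mset LC + replicate_mset (length es) (real n / (real n - 1))
      = image_mset ?q (eig_mset ?RR) + replicate_mset (length ws) (real n / (real n - 1))"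
    using arg_cong[OF clique_spec, of "image_mset ?p"]
    by (simp only: image_mset_union multiset.map_comp o_def pLC shift pshift image_replicate_mset diff_0_right multiset.map_ident)
  have E: "image_mset (\<lambda>x. x / (real n - 1)) (eig_mset LG) + replicate_mset (length es) (2 / (real n - 1))
      = image_mset ?q (eig_mset ?RR) + replicate_mset (length vs) (2 / (real n - 1))"
    using arg_cong[OF edge_spec, of "image_mset ?q"]
    by (simp only: image_mset_union multiset.map_comp o_def qLG image_replicate_mset diff_0_right)
  show ?thesis using C E by (simp add: len[symmetric] ac_simps)
qed

lemma replicate_mset_add: "replicate_mset (k + l) x = replicate_mset k x + replicate_mset l x"
  by (intro multiset_eqI) auto

theorem theorem3p3:
  fixes G :: "'a pair_pre_digraph"
    and n N0 E0 :: nat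
    and vs :: "'a list" and ws :: "'a cl_vertex list"
    and LG LC :: "real mat"
  assumes "n \<ge> 3"
    and "pair_graph G" and "connected (with_proj G)"
    and "N0 = card (pverts G)" and "E0 = card (edges G)" and "E0 \<ge> 1"
    and "distinct vs" and "set vs = pverts G"
    and "distinct ws" and "set ws = pverts (clique_blowup n G)"
    and "LG = normalized_laplacian G vs"
    and "LC = normalized_laplacian (clique_blowup n G) ws"
  shows
    "(eigenvalue LC 0 \<and> eig_mult LC 0 = 1)
     \<and> (\<forall>l. eigenvalue LG l \<and> l \<noteq> 0 \<and> l \<noteq> 2 \<longrightarrow>
          eigenvalue LC (l / (real n - 1)) \<and>
          eig_mult LC (l / (real n - 1)) = eig_mult LG l)
     \<and> (\<not> bipartite G \<longrightarrow>
          int (eig_mult LC (2 / (real n - 1))) = int E0 - int N0 \<and>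
          (eigenvalue LC (2 / (real n - 1)) \<longleftrightarrow> int E0 - int N0 \<noteq> 0))
     \<and> (bipartite G \<longrightarrow>
          int (eig_mult LC (2 / (real n - 1))) = int E0 - int N0 + 1 \<and>
          (eigenvalue LC (2 / (real n - 1)) \<longleftrightarrow> int E0 - int N0 + 1 \<noteq> 0))
     \<and> (eigenvalue LC (real n / (real n - 1)) \<and>
          eig_mult LC (real n / (real n - 1)) = (n - 3) * E0 + N0)
     \<and> eig_mset LC =
          {#0#}
          + image_mset (\<lambda>x. x / (real n - 1)) (filter_mset (\<lambda>x. x \<noteq> 0 \<and> x \<noteq> 2) (eig_mset LG))
          + replicate_mset (if bipartite G then E0 + 1 - N0 else E0 - N0) (2 / (real n - 1))
          + replicate_mset ((n - 3) * E0 + N0) (real n / (real n - 1))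
     \<and> size (eig_mset LC) = dim_row LC"
proof -
  note n = assms(1) and G = assms(2) and conn = assms(3) and N0 = assms(4) and E0 = assms(5)
  have ne: "edges G \<noteq> {}" using assms(5,6) by auto
  have n2: "n \<ge> 2" using n by simp
  interpret P: clique_partition "clique_blowup n G" n "clique_of n ` edges G"
    by (rule clique_partition_blowup[OF G conn ne n2])
  define m where "m = real n - 1"
  have m: "m \<noteq> 0" "m > 0" and nm: "real n \<noteq> 2" using n by (auto simp: m_def)
  define a where "a = 2 / m"
  define b where "b = real n / m"
  define F where "F = filter_mset (\<lambda>x. x \<noteq> 0 \<and> x \<noteq> 2) (eig_mset LG)"
  define \<beta> :: nat where "\<beta> = (if bipartite G then 1 else 0)"
  have LG: "LG \<in> carrier_mat (length vs) (length vs)" and LC: "LC \<in> carrier_mat (length ws) (length ws)"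
    by (simp_all add: assms(11,12))
  have ab: "a \<noteq> 0" "b \<noteq> 0" "a \<noteq> b" using m nm n by (auto simp: a_def b_def)
  have split: "eig_mset LG = {#0#} + F + replicate_mset \<beta> 2"
    using eig_mset_laplacian_split[OF G conn ne assms(7,8)] by (simp add: assms(11) F_def \<beta>_def)
  have card: "card (pverts (clique_blowup n G)) = (n - 3) * E0 + N0 + E0"
  proof -
    have "n - 2 = Suc (n - 3)" using n by simp
    then show ?thesis using card_blowup_verts[OF G, of n] by (simp add: N0 E0)
  qed
  have "eig_mset LC + replicate_mset E0 b + replicate_mset N0 a
      = image_mset (\<lambda>x. x / m) (eig_mset LG) + replicate_mset E0 a
        + replicate_mset ((n - 3) * E0 + N0 + E0) b"
    using blowup_spectrum_balance[OF G conn ne n2 assms(7-10)]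
    by (simp add: assms(11,12) N0[symmetric] E0[symmetric] card m_def a_def b_def)
  then have "replicate_mset E0 b + (eig_mset LC + replicate_mset N0 a)
      = replicate_mset E0 b + ({#0#} + image_mset (\<lambda>x. x / m) F + replicate_mset (E0 + \<beta>) a
        + replicate_mset ((n - 3) * E0 + N0) b)"
    by (simp add: split a_def replicate_mset_add ac_simps)
  then have bal: "eig_mset LC + replicate_mset N0 a
      = {#0#} + image_mset (\<lambda>x. x / m) F + replicate_mset (E0 + \<beta>) a
        + replicate_mset ((n - 3) * E0 + N0) b"
    by (rule add_left_imp_eq)
  have count_F: "count (image_mset (\<lambda>x. x / m) F) (l / m) = count F l" for l
    using m by (induction F) auto
  have F0: "count F 0 = 0" "count F 2 = 0" by (simp_all add: F_def)
  have Fa: "count (image_mset (\<lambda>x. x / m) F) a = 0"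
    using count_F[of 2] F0 by (simp add: a_def)
  \<comment> \<open>No eigenvalue in \<open>F\<close> is sent to \<open>a\<close>, so counting \<open>a\<close> shows that \<open>N0\<close> copies can be cancelled.\<close>
  have "count (eig_mset LC + replicate_mset N0 a) a = E0 + \<beta>"
    unfolding bal using ab Fa by simp
  then have le: "N0 \<le> E0 + \<beta>" by simp
  then have "replicate_mset (E0 + \<beta>) a = replicate_mset (E0 + \<beta> - N0) a + replicate_mset N0 a"
    by (simp add: replicate_mset_add[symmetric])
  then have "replicate_mset N0 a + eig_mset LC
      = replicate_mset N0 a + ({#0#} + image_mset (\<lambda>x. x / m) F + replicate_mset (E0 + \<beta> - N0) a
        + replicate_mset ((n - 3) * E0 + N0) b)"
    using bal by (simp add: ac_simps)
  then have spec: "eig_mset LC = {#0#} + image_mset (\<lambda>x. x / m) F + replicate_mset (E0 + \<beta> - N0) a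
        + replicate_mset ((n - 3) * E0 + N0) b"
    by (rule add_left_imp_eq)
  \<comment> \<open>An eigenvalue \<open>n\<close> of \<open>G\<close> would be sent to \<open>b\<close>, but no eigenvalue of \<open>G\<close> exceeds 2.\<close>
  have Fn: "count F n = 0"
  proof -
    interpret E: clique_partition G 2 "edges G" by (rule clique_partition_edges[OF G conn ne])
    have "real n \<notin># eig_mset LG"
      using E.eigenvalue_le[OF assms(7,8), of "real n"] n by (auto simp: assms(11))
    then show ?thesis by (auto simp: F_def not_in_iff)
  qed
  have Fb: "count (image_mset (\<lambda>x. x / m) F) b = 0"
    using count_F[of n] Fn by (simp add: b_def)
  have FC0: "count (image_mset (\<lambda>x. x / m) F) 0 = 0"
    using count_F[of 0] F0 by simp
  have mult: "eig_mult LC x = count (eig_mset LC) x" for x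
    using count_eig_mset[OF LC] by simp
  have ev: "eigenvalue LC x \<longleftrightarrow> eig_mult LC x > 0" for x
    using eigenvalue_iff_in_eig_mset[OF LC] by (simp add: mult)
  have m0: "eig_mult LC 0 = 1" and ma: "eig_mult LC a = E0 + \<beta> - N0"
    and mb: "eig_mult LC b = (n - 3) * E0 + N0"
    unfolding mult spec using ab FC0 Fa Fb by simp_all
  have ml: "eig_mult LC (l / m) = eig_mult LG l" if l: "eigenvalue LG l" "l \<noteq> 0" "l \<noteq> 2" for l
  proof -
    have "l \<in># eig_mset LG" using l(1) eigenvalue_iff_in_eig_mset[OF LG] by simp
    then have "l \<in># F" using l by (simp add: F_def)
    then have "l \<noteq> n" using Fn by (metis not_in_iff)
    then have "l / m \<noteq> a" "l / m \<noteq> b" "l / m \<noteq> 0"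
      using m l by (auto simp: a_def b_def)
    then have "eig_mult LC (l / m) = count F l"
      unfolding mult spec using count_F[of l] by simp
    also have "\<dots> = eig_mult LG l"
      using count_eig_mset[OF LG, of l] l by (simp add: F_def)
    finally show ?thesis .
  qed
  have el: "eig_mult LG l > 0" if "eigenvalue LG l" for l
    using that eigenvalue_iff_in_eig_mset[OF LG] count_eig_mset[OF LG]
    by (metis count_greater_zero_iff)
  have N0_pos: "N0 > 0"
  proof -
    interpret E: clique_partition G 2 "edges G" by (rule clique_partition_edges[OF G conn ne])
    have "pverts G \<noteq> {}" using conn by (simp add: connected_conv)
    then show ?thesis using E.finite_verts by (simp add: N0 card_gt_0_iff)
  qed
  have size: "size (eig_mset LC) = dim_row LC"
    using size_eig_mset_symmetric[OF LC] carrier_matD(1)[OF LC]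
      normalized_laplacian_symmetric[OF P.sym_arcs, of ws] by (simp add: assms(12)[symmetric])
  have reps: "E0 + \<beta> - N0 = (if bipartite G then E0 + 1 - N0 else E0 - N0)"
    by (simp add: \<beta>_def)
  show ?thesis
    unfolding m_def[symmetric] a_def[symmetric] b_def[symmetric] F_def[symmetric] reps[symmetric]
  proof (intro conjI allI impI)
    show "eig_mset LC = {#0#} + image_mset (\<lambda>x. x / m) F + replicate_mset (E0 + \<beta> - N0) a
        + replicate_mset ((n - 3) * E0 + N0) b" by (rule spec)
  qed (use m0 ma mb ml el ev le N0_pos size in \<open>auto simp: \<beta>_def\<close>)
qed

end
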